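(* Let $q\geq 2$ be an integer. For every integer $n\geq 4$, let $K^*_n$ be the best constant associated with the $n$-distance $d\colon(\mathbb{R}^q)^n\to\mathbb{R}_+$ that carries $(x_1,\ldots,x_n)$ into the diameter of a largest inner ball associated with $x_1,\ldots,x_n$, and let $p=\lfloor n/2\rfloor-1$. Then $$K^*_n\ \geq\ \frac{1}{n\lambda_n}\ >\ \frac{1}{n\,\sin\frac{\pi}{2p+4}}\ >\ \frac{2p+4}{n\pi}\ >\ \frac{1}{\pi},$$ where $\lambda_n$ is the unique solution to the equation $$T_p(\sqrt{1-x^2})=2x$$ lying in the open interval $\left]0,\sin\frac{\pi}{2p+4}\right[$, and $T_p$ denotes the $p$th degree Chebyshev polynomial of the first kind. Moreover, $$\lim_{n\to\infty}\frac{1}{n\lambda_n}=\frac{1}{\pi}.$$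
   Context: $\mathbb{R}_+=[0,+\infty[$. For a set $X$ with at least two elements and an integer $n\geq 2$, an $n$-distance on $X$ is a map $d\colon X^n\to\mathbb{R}_+$ such that: (i) $d(x_1,\ldots,x_n)=0$ if and only if $x_1=\cdots=x_n$; (ii) $d$ is invariant under any permutation of its arguments; (iii) $d(x_1,\ldots,x_n)\leq\sum_{i=1}^n d(x_1,\ldots,x_n)_i^z$ for all $x_1,\ldots,x_n,z\in X$, where $d(x_1,\ldots,x_n)_i^z$ denotes the value obtained from $d(x_1,\ldots,x_n)$ by replacing its $i$th argument by $z$. The best constant associated with an $n$-distance $d$ on $X$ is $$K^*_n=\sup\left\{\frac{d(x_1,\ldots,x_n)}{\sum_{i=1}^n d(x_1,\ldots,x_n)_i^z}: x_1,\ldots,x_n,z\in X,\ |\{x_1,\ldots,x_n\}|\geq 2\right\}.$$ A (closed) Euclidean $q$-ball of radius $r>0$ centered at $c\in\mathbb{R}^q$ is $\{x\in\mathbb{R}^q:|x-c|\leq r\}$, where $|\cdot|$ is the Euclidean norm. Given points $x_1,\ldots,x_n\in\mathbb{R}^q$, a Euclidean $q$-ball $B$ is an inner ball associated with $x_1,\ldots,x_n$ if: (1) the interior of $B$ contains none of the points $x_1,\ldots,x_n$; and (2) two of the points $x_1,\ldots,x_n$ are the endpoints of a diameter of $B$. When $x_1=\cdots=x_n$, there is no such ball and $d(x_1,\ldots,x_n)=0$ by convention. *)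

theory Defs
  imports "HOL-Analysis.Analysis" "HOL-Library.Multiset" "HOL-Computational_Algebra.Polynomial"
begin

text \<open>
  An element \<open>(x\<^sub>1, \<dots>, x\<^sub>n)\<close> of \<open>X\<^sup>n\<close> is a list of length \<open>n\<close> with elements in \<open>X\<close>, with
  indices running from \<open>0\<close> to \<open>n - 1\<close>; replacing the \<open>i\<close>-th argument by \<open>z\<close> is
  \<open>xs[i := z]\<close>. Values of \<open>d\<close> on lists of other lengths are irrelevant.
\<close>

definition n_distance :: "'a set \<Rightarrow> nat \<Rightarrow> ('a list \<Rightarrow> real) \<Rightarrow> bool" where
  "n_distance X n d \<longleftrightarrow>
     (\<exists>x\<in>X. \<exists>y\<in>X. x \<noteq> y) \<and> n \<ge> 2 \<and>
     (\<forall>xs. length xs = n \<and> set xs \<subseteq> X \<longrightarrow>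
        d xs \<ge> 0 \<and>
        (d xs = 0 \<longleftrightarrow> (\<forall>x\<in>set xs. \<forall>y\<in>set xs. x = y)) \<and>
        (\<forall>ys. mset ys = mset xs \<longrightarrow> d ys = d xs) \<and>
        (\<forall>z\<in>X. d xs \<le> (\<Sum>i<n. d (xs[i := z]))))"

text \<open>
  The supremum is taken in the reals. If \<open>d\<close> is an \<open>n\<close>-distance on \<open>X\<close>, the denominators are
  positive, the quotients are at most 1 and the set is nonempty.
\<close>

definition best_constant :: "'a set \<Rightarrow> nat \<Rightarrow> ('a list \<Rightarrow> real) \<Rightarrow> real" where
  "best_constant X n d =
     Sup {d xs / (\<Sum>i<n. d (xs[i := z])) | xs z.
            length xs = n \<and> set xs \<subseteq> X \<and> z \<in> X \<and> card (set xs) \<ge> 2}"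

text \<open>
  The conditions \<open>c = midpoint a b\<close> and \<open>dist a b = 2 * r\<close> say that \<open>a\<close> and \<open>b\<close> are the
  endpoints of a diameter of \<open>cball c r\<close>; \<open>a \<noteq> b\<close> follows from \<open>r > 0\<close>.
\<close>

definition inner_ball :: "'a::euclidean_space list \<Rightarrow> 'a \<Rightarrow> real \<Rightarrow> bool" where
  "inner_ball xs c r \<longleftrightarrow>
     r > 0 \<and>
     (\<forall>x\<in>set xs. x \<notin> interior (cball c r)) \<and>
     (\<exists>a\<in>set xs. \<exists>b\<in>set xs. c = midpoint a b \<and> dist a b = 2 * r)"

text \<open>
  When the points are not all equal, the set below is finite (each inner ball is determined by a
  pair of the points) and nonempty (two distinct points at minimal distance give an inner ball).
\<close>

definition largest_inner_diameter :: "'a::euclidean_space list \<Rightarrow> real" where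
  "largest_inner_diameter xs =
     (if \<forall>x\<in>set xs. \<forall>y\<in>set xs. x = y then 0
      else Max {diameter (cball c r) | c r. inner_ball xs c r})"

fun chebyshev_T :: "nat \<Rightarrow> real poly" where
  "chebyshev_T 0 = 1"
| "chebyshev_T (Suc 0) = [:0, 1:]"
| "chebyshev_T (Suc (Suc n)) = [:0, 2:] * chebyshev_T (Suc n) - chebyshev_T n"

text \<open>The natural number \<open>\<lfloor>n / 2\<rfloor> - 1\<close>; the subtraction does not truncate for \<open>n \<ge> 2\<close>.\<close>

definition cheb_index :: "nat \<Rightarrow> nat" where
  "cheb_index n = n div 2 - 1"

definition lambda_solution :: "nat \<Rightarrow> real \<Rightarrow> bool" where
  "lambda_solution p x \<longleftrightarrow>
     x \<in> {0<..<sin (pi / (2 * real p + 4))} \<and>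
     poly (chebyshev_T p) (sqrt (1 - x\<^sup>2)) = 2 * x"

definition lambda :: "nat \<Rightarrow> real" where
  "lambda n = (THE x. lambda_solution (cheb_index n) x)"

end

theory Submission imports Defs "HOL-Real_Asymp.Real_Asymp"
begin

text \<open>
  A ball whose diameter joins two points \<open>a\<close> and \<open>b\<close> of a finite set \<open>S\<close> is an inner ball exactly if
  no point of \<open>S\<close> sees \<open>a\<close> and \<open>b\<close> under an obtuse angle, that is, if \<open>ab\<close> is an edge of the Gabriel
  graph of \<open>S\<close>. So \<open>d\<close> is the length of a longest edge of this graph.

  A closest pair across any cut of \<open>S\<close> is such an edge (\<open>gabriel_pair_across_cut\<close>). Hence two points
  of a list of length \<open>n\<close> are at distance at most \<open>n - 1\<close> times the value of \<open>d\<close>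
  (\<open>dist_le_length_times_largest_inner_diameter\<close>). If \<open>D\<close> is the value of \<open>d\<close>, then \<open>n - 2\<close> of the
  summands in the simplex inequality are at least \<open>D / (n - 1)\<close> each, and the sum of the other two
  is at least \<open>D / (n - 1)\<close>. So \<open>d\<close> is an \<open>n\<close>-distance, and the quotients that define the best
  constant are at most \<open>1\<close>.

  The lower bound comes from an explicit configuration. With \<open>x = sin t\<close>, the equation for \<open>lambda n\<close>
  becomes \<open>cos (p t) = 2 sin t\<close>. It says that a half circle of radius \<open>1\<close> from \<open>u\<close> to \<open>- u\<close> carries a
  chain of \<open>p\<close> chords of length \<open>2 * lambda n\<close>, followed by a chord of length \<open>4 * lambda n\<close>. The end
  points of the \<open>p\<close> short chords other than \<open>u\<close> are taken twice, together with \<open>u\<close> and \<open>- u\<close>. The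
  value of \<open>d\<close> is at least \<open>2\<close>, as all points are on the boundary of the unit ball. But if \<open>z\<close>, a point
  close to the midpoint of the long chord, replaces any of the points, then only consecutive
  points of the chain through \<open>z\<close> remain joined by Gabriel edges (\<open>gabriel_distance_le\<close>), and the
  value drops to about \<open>2 * lambda n\<close>. This gives quotients arbitrarily close to
  \<open>1 / (n * lambda n)\<close> or above.

  The remaining inequalities and the limit follow from \<open>sin (pi / (2 p + 6)) < lambda n\<close> and
  \<open>lambda n < sin (pi / (2 p + 4))\<close>, where \<open>2 p + 2\<close> is \<open>n\<close> or \<open>n - 1\<close>.
\<close>

section \<open>Inner balls as Gabriel pairs\<close>

text \<open>
  Such a pair is an edge of the Gabriel graph of \<open>S\<close>: by Thales, \<open>w\<close> lies in the open ball with
  diameter \<open>ab\<close> exactly if the angle at \<open>w\<close> is obtuse. An inner product per point is easier to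
  handle than the midpoint and the radius of the ball.
\<close>

definition gabriel_pair :: "'a::real_inner set \<Rightarrow> 'a \<Rightarrow> 'a \<Rightarrow> bool" where
  "gabriel_pair S a b \<longleftrightarrow> a \<in> S \<and> b \<in> S \<and> a \<noteq> b \<and> (\<forall>w\<in>S. 0 \<le> (a - w) \<bullet> (b - w))"

lemma gabriel_pair_commute: "gabriel_pair S a b \<longleftrightarrow> gabriel_pair S b a"
  by (auto simp: gabriel_pair_def inner_commute)

lemma inner_diff_eq_midpoint:
  fixes a b w :: "'a::real_inner"
  shows "(a - w) \<bullet> (b - w) = (dist (midpoint a b) w)\<^sup>2 - (dist a b / 2)\<^sup>2"
proof -
  have e1: "midpoint a b - w = (1/2) *\<^sub>R ((a - w) + (b - w))"
    by (simp add: midpoint_def algebra_simps scaleR_half_double flip: scaleR_add_left)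
  have e2: "a - b = (a - w) - (b - w)" by simp
  show ?thesis
    unfolding dist_norm e1 e2 power_divide
    by (simp add: power2_norm_eq_inner power_mult_distrib inner_simps inner_commute field_simps power2_eq_square
        flip: power2_eq_square)
qed

lemma inner_ball_iff_gabriel_pair:
  fixes xs :: "'a::euclidean_space list"
  shows "inner_ball xs c r \<longleftrightarrow>
    (\<exists>a b. gabriel_pair (set xs) a b \<and> c = midpoint a b \<and> r = dist a b / 2)"
proof -
  have out: "0 \<le> (a - w) \<bullet> (b - w) \<longleftrightarrow> w \<notin> interior (cball (midpoint a b) (dist a b / 2))"
    for a b w :: 'a
    unfolding inner_diff_eq_midpoint interior_cball
    by (simp add: not_less abs_le_square_iff[symmetric])
  show ?thesis
    unfolding inner_ball_def gabriel_pair_def out by fastforce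
qed

lemma inner_ball_diameters:
  fixes xs :: "'a::euclidean_space list"
  shows "{diameter (cball c r) | c r. inner_ball xs c r} =
    {dist a b | a b. gabriel_pair (set xs) a b}"
proof -
  have "{diameter (cball c r) | c r. inner_ball xs c r} =
      {diameter (cball (midpoint a b) (dist a b / 2)) | a b. gabriel_pair (set xs) a b}"
    unfolding inner_ball_iff_gabriel_pair by blast
  then show ?thesis by simp
qed

lemma finite_gabriel_distances:
  assumes "finite S"
  shows "finite {dist a b | a b. gabriel_pair S a b}"
  by (rule finite_subset[of _ "(\<lambda>(a, b). dist a b) ` (S \<times> S)"])
     (use assms in \<open>auto simp: gabriel_pair_def\<close>)

text \<open>
  A closest pair across a cut of \<open>S\<close> works: a point \<open>w\<close> at which the angle is obtuse is closer to
  both ends than they are to each other, and one of the pairs \<open>(a, w)\<close> and \<open>(w, b)\<close> crosses the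
  cut as well. Hence inner balls exist, and every cut is crossed by one.
\<close>

lemma gabriel_pair_across_cut:
  fixes S :: "'a::real_inner set"
  assumes fin: "finite S" and A: "A \<subseteq> S" "A \<noteq> {}" "A \<noteq> S"
  obtains a b where "a \<in> A" "b \<in> S - A" "gabriel_pair S a b"
proof -
  let ?C = "A \<times> (S - A)"
  have "finite ?C" "?C \<noteq> {}" using A fin finite_subset[OF A(1) fin] by auto
  then obtain c where c: "c \<in> ?C" "\<And>c'. c' \<in> ?C \<Longrightarrow> (\<lambda>(a, b). dist a b) c \<le> (\<lambda>(a, b). dist a b) c'"
    using arg_min_if_finite[of ?C "\<lambda>(a, b). dist a b"] by (metis not_le)
  obtain a b where ab: "c = (a, b)" by fastforce
  have mem: "a \<in> A" "b \<in> S" "b \<notin> A" using c(1) ab by auto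
  have min: "dist a b \<le> dist a' b'" if "a' \<in> A" "b' \<in> S" "b' \<notin> A" for a' b'
    using c(2)[of "(a', b')"] that ab by auto
  have "0 \<le> (a - w) \<bullet> (b - w)" if w: "w \<in> S" for w
  proof (rule ccontr)
    assume neg: "\<not> 0 \<le> (a - w) \<bullet> (b - w)"
    have "(dist a b)\<^sup>2 = (dist a w)\<^sup>2 + (dist w b)\<^sup>2 - 2 * ((a - w) \<bullet> (b - w))"
      by (simp add: dist_norm power2_norm_eq_inner inner_simps inner_commute)
    then have "(dist a w)\<^sup>2 < (dist a b)\<^sup>2" "(dist w b)\<^sup>2 < (dist a b)\<^sup>2"
      using neg zero_le_power2[of "dist a w"] zero_le_power2[of "dist w b"] by linarith+
    then have "dist a w < dist a b" "dist w b < dist a b"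
      by (auto intro: power2_less_imp_less)
    then show False using min[of a w] min[of w b] mem w by (cases "w \<in> A") auto
  qed
  then have "gabriel_pair S a b"
    using mem A by (auto simp: gabriel_pair_def)
  then show ?thesis using that mem by blast
qed

section \<open>The largest inner diameter is an n-distance\<close>

lemma largest_inner_diameter_attained:
  fixes xs :: "'a::euclidean_space list"
  assumes "x \<in> set xs" "y \<in> set xs" "x \<noteq> y"
  obtains a b where "gabriel_pair (set xs) a b" "largest_inner_diameter xs = dist a b"
proof -
  let ?D = "{dist a b | a b. gabriel_pair (set xs) a b}"
  obtain a b where "gabriel_pair (set xs) a b"
  proof (rule gabriel_pair_across_cut[of "set xs" "{x}"])
    show "{x} \<noteq> set xs" using assms by auto
  qed (use assms in auto)
  then have "?D \<noteq> {}" by blast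
  then have "Max ?D \<in> ?D" using finite_gabriel_distances[of "set xs"] by (intro Max_in) auto
  moreover have "largest_inner_diameter xs = Max ?D"
    unfolding largest_inner_diameter_def inner_ball_diameters using assms by auto
  ultimately show ?thesis using that by auto
qed

lemma gabriel_pair_le_largest_inner_diameter:
  fixes xs :: "'a::euclidean_space list"
  assumes "gabriel_pair (set xs) a b"
  shows "dist a b \<le> largest_inner_diameter xs"
proof -
  have "\<not> (\<forall>x\<in>set xs. \<forall>y\<in>set xs. x = y)" using assms unfolding gabriel_pair_def by blast
  then have "largest_inner_diameter xs = Max {dist a b | a b. gabriel_pair (set xs) a b}"
    by (simp only: largest_inner_diameter_def inner_ball_diameters if_False)
  then show ?thesis
    using Max_ge[OF finite_gabriel_distances[of "set xs"], of "dist a b"] assms by auto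
qed

lemma largest_inner_diameter_le:
  fixes xs :: "'a::euclidean_space list"
  assumes "\<And>a b. gabriel_pair (set xs) a b \<Longrightarrow> dist a b \<le> C" "0 \<le> C"
  shows "largest_inner_diameter xs \<le> C"
proof (cases "\<forall>x\<in>set xs. \<forall>y\<in>set xs. x = y")
  case True
  then show ?thesis using assms(2) by (simp add: largest_inner_diameter_def)
next
  case False
  then obtain a b where "gabriel_pair (set xs) a b" "largest_inner_diameter xs = dist a b"
    using largest_inner_diameter_attained by blast
  then show ?thesis using assms(1) by simp
qed

lemma largest_inner_diameter_nonneg: "0 \<le> largest_inner_diameter xs"
proof (cases "\<forall>x\<in>set xs. \<forall>y\<in>set xs. x = y")
  case False
  then obtain a b where "gabriel_pair (set xs) a b" "largest_inner_diameter xs = dist a b"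
    using largest_inner_diameter_attained by blast
  then show ?thesis by simp
qed (simp add: largest_inner_diameter_def)

lemma largest_inner_diameter_eq_0_iff:
  "largest_inner_diameter xs = 0 \<longleftrightarrow> (\<forall>x\<in>set xs. \<forall>y\<in>set xs. x = y)"
proof (cases "\<forall>x\<in>set xs. \<forall>y\<in>set xs. x = y")
  case False
  then obtain a b where "gabriel_pair (set xs) a b" "largest_inner_diameter xs = dist a b"
    using largest_inner_diameter_attained by blast
  then show ?thesis using False by (simp add: gabriel_pair_def)
qed (simp add: largest_inner_diameter_def)

lemma largest_inner_diameter_cong_set:
  assumes "set xs = set ys"
  shows "largest_inner_diameter xs = largest_inner_diameter ys"
  by (simp add: largest_inner_diameter_def inner_ball_def assms)

text \<open>
  Balls around \<open>x\<close> whose radii are the multiples of the largest inner diameter gain a point at each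
  step until they contain all points, because an inner diameter crosses the cut between the
  points inside and outside.
\<close>

lemma card_within_multiple_of_largest_inner_diameter:
  fixes xs :: "'a::euclidean_space list"
  assumes x: "x \<in> set xs"
  shows "min (Suc k) (card (set xs)) \<le>
    card {w \<in> set xs. dist x w \<le> real k * largest_inner_diameter xs}"
proof (induction k)
  case 0
  have "{w \<in> set xs. dist x w \<le> 0} = {x}" using x by auto
  then show ?case by simp
next
  case (Suc k)
  let ?d = "largest_inner_diameter xs"
  let ?A = "\<lambda>k. {w \<in> set xs. dist x w \<le> real k * ?d}"
  have mono: "?A k \<subseteq> ?A (Suc k)"
    using largest_inner_diameter_nonneg[of xs] by (auto simp: distrib_right intro: order_trans)
  show ?case
  proof (cases "?A k = set xs")
    case True
    then have "?A (Suc k) = set xs" using mono by blast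
    then show ?thesis by simp
  next
    case False
    moreover have "x \<in> ?A k" using x largest_inner_diameter_nonneg[of xs] by simp
    then have "?A k \<noteq> {}" by blast
    ultimately obtain a b where ab: "a \<in> ?A k" "b \<in> set xs - ?A k" "gabriel_pair (set xs) a b"
      using gabriel_pair_across_cut[of "set xs" "?A k"] by blast
    have "dist x b \<le> dist x a + dist a b" by (rule dist_triangle)
    also have "\<dots> \<le> real k * ?d + ?d"
      using ab gabriel_pair_le_largest_inner_diameter[OF ab(3)] by (intro add_mono) auto
    finally have "b \<in> ?A (Suc k)" using ab(2) by (simp add: algebra_simps)
    then have "?A k \<subset> ?A (Suc k)" using ab(2) mono by blast
    then have "card (?A k) < card (?A (Suc k))" by (intro psubset_card_mono) auto
    then show ?thesis using Suc.IH by linarith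
  qed
qed

lemma dist_le_length_times_largest_inner_diameter:
  fixes xs :: "'a::euclidean_space list"
  assumes "x \<in> set xs" "y \<in> set xs"
  shows "dist x y \<le> real (length xs - 1) * largest_inner_diameter xs"
proof -
  let ?d = "largest_inner_diameter xs"
  let ?B = "{w \<in> set xs. dist x w \<le> real (length xs - 1) * ?d}"
  have "0 < length xs" using assms by (cases xs) auto
  then have "card (set xs) \<le> card ?B"
    using card_within_multiple_of_largest_inner_diameter[OF assms(1), of "length xs - 1"]
      card_length[of xs] by simp
  then have "?B = set xs" by (intro card_seteq) auto
  then show ?thesis using assms(2) by blast
qed

text \<open>
  Let the largest inner ball have the diameter \<open>ab\<close>, with \<open>a\<close> and \<open>b\<close> at the positions \<open>i\<close> and \<open>j\<close>. A change at any of the other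
  \<open>n - 2\<close> positions keeps both \<open>a\<close> and \<open>b\<close>, and so leaves the value at least
  \<open>dist a b / (n - 1)\<close>. The changes at \<open>i\<close> and \<open>j\<close> leave \<open>z, b\<close> and \<open>a, z\<close>, and together they
  contribute at least one more such share, by the triangle inequality.
\<close>

lemma largest_inner_diameter_simplex_inequality:
  fixes xs :: "'a::euclidean_space list"
  assumes "length xs = n" "2 \<le> n"
  shows "largest_inner_diameter xs \<le> (\<Sum>i<n. largest_inner_diameter (xs[i := z]))"
proof (cases "\<forall>x\<in>set xs. \<forall>y\<in>set xs. x = y")
  case True
  then have "largest_inner_diameter xs = 0" by (simp add: largest_inner_diameter_def)
  then show ?thesis using largest_inner_diameter_nonneg by (metis sum_nonneg)
next
  case False
  then obtain a b where g: "gabriel_pair (set xs) a b" "largest_inner_diameter xs = dist a b"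
    using largest_inner_diameter_attained by blast
  let ?e = "\<lambda>i. largest_inner_diameter (xs[i := z])"
  obtain i j where ij: "i < n" "j < n" "xs ! i = a" "xs ! j = b" "i \<noteq> j"
    using g(1) assms by (metis gabriel_pair_def in_set_conv_nth)
  have upd: "xs ! k \<in> set (xs[l := z])" if "k < n" "k \<noteq> l" for k l
    using that assms by (metis length_list_update nth_list_update_neq nth_mem)
  have z: "z \<in> set (xs[l := z])" if "l < n" for l
    using that assms by (simp add: set_update_memI)
  have len: "dist x y \<le> real (n - 1) * ?e l" if "x \<in> set (xs[l := z])" "y \<in> set (xs[l := z])" for x y l
    using dist_le_length_times_largest_inner_diameter[OF that] assms by simp
  have rest: "dist a b \<le> real (n - 1) * ?e l" if "l \<in> {..<n} - {i, j}" for l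
    using that upd[of i l] upd[of j l] ij by (intro len) auto
  have "dist a b \<le> dist z b + dist a z" using dist_triangle[of a b z] by simp
  also have "\<dots> \<le> real (n - 1) * ?e i + real (n - 1) * ?e j"
    using upd[of j i] upd[of i j] z ij by (intro add_mono len) auto
  finally have two: "dist a b \<le> real (n - 1) * ?e i + real (n - 1) * ?e j" .
  have "real (n - 1) * dist a b = real (n - 2) * dist a b + dist a b"
    using assms(2) by (simp add: of_nat_diff algebra_simps)
  also have "real (n - 2) * dist a b = (\<Sum>l\<in>{..<n} - {i, j}. dist a b)"
    using ij by (simp add: card_Diff_subset)
  also have "\<dots> \<le> (\<Sum>l\<in>{..<n} - {i, j}. real (n - 1) * ?e l)"
    by (intro sum_mono rest)
  also have "(\<Sum>l\<in>{..<n} - {i, j}. real (n - 1) * ?e l) + dist a b \<le>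
      (\<Sum>l\<in>{..<n} - {i, j}. real (n - 1) * ?e l) + (\<Sum>l\<in>{i, j}. real (n - 1) * ?e l)"
    using two ij by simp
  also have "\<dots> = (\<Sum>l<n. real (n - 1) * ?e l)"
    using ij by (intro sum.subset_diff[symmetric]) auto
  also have "\<dots> = real (n - 1) * (\<Sum>l<n. ?e l)"
    by (rule sum_distrib_left[symmetric])
  finally have "real (n - 1) * dist a b \<le> real (n - 1) * (\<Sum>l<n. ?e l)" by simp
  then show ?thesis using assms(2) g(2) by simp
qed

lemma n_distance_largest_inner_diameter:
  assumes "2 \<le> n"
  shows "n_distance (UNIV :: 'a::euclidean_space set) n largest_inner_diameter"
proof -
  have "\<exists>x y :: 'a. x \<noteq> y" using nonempty_Basis nonzero_Basis by blast
  moreover have "largest_inner_diameter ys = largest_inner_diameter xs"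
    if "mset ys = mset xs" for xs ys :: "'a list"
    using largest_inner_diameter_cong_set mset_eq_setD that by blast
  ultimately show ?thesis
    unfolding n_distance_def
    using assms largest_inner_diameter_nonneg largest_inner_diameter_eq_0_iff
      largest_inner_diameter_simplex_inequality by blast
qed

lemma quotient_le_best_constant:
  assumes nd: "n_distance X n d"
    and "length xs = n" "set xs \<subseteq> X" "z \<in> X" "card (set xs) \<ge> 2"
  shows "d xs / (\<Sum>i<n. d (xs[i := z])) \<le> best_constant X n d"
  unfolding best_constant_def
proof (rule cSup_upper)
  show "bdd_above {d xs / (\<Sum>i<n. d (xs[i := z])) | xs z.
      length xs = n \<and> set xs \<subseteq> X \<and> z \<in> X \<and> card (set xs) \<ge> 2}"
  proof (rule bdd_aboveI[of _ 1], clarify)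
    fix xs z assume *: "n = length xs" "set xs \<subseteq> X" "z \<in> X"
    then have "0 \<le> d xs" "d xs \<le> (\<Sum>i<length xs. d (xs[i := z]))"
      using nd unfolding n_distance_def by blast+
    then show "d xs / (\<Sum>i<length xs. d (xs[i := z])) \<le> 1" by (intro divide_le_eq_1[THEN iffD2]) linarith
  qed
qed (use assms in blast)

section \<open>The trigonometric form of the Chebyshev equation\<close>

lemma poly_chebyshev_T_cos: "poly (chebyshev_T n) (cos t) = cos (real n * t)"
proof (induction n rule: chebyshev_T.induct)
  case (3 n)
  have "cos (real (Suc (Suc n)) * t) + cos (real n * t) = 2 * cos t * cos (real (Suc n) * t)"
    using cos_add[of "real (Suc n) * t" t] cos_diff[of "real (Suc n) * t" t]
    by (simp add: algebra_simps)
  with 3 show ?case by (simp add: algebra_simps)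
qed auto

text \<open>
  The substitution \<open>x = sin t\<close> turns the Chebyshev equation into \<open>cos (p t) = 2 sin t\<close>, whose two
  sides are monotone in opposite directions.
\<close>

lemma lambda_solution_iff:
  "lambda_solution p x \<longleftrightarrow>
    (\<exists>t. 0 < t \<and> t < pi / (2 * real p + 4) \<and> x = sin t \<and> cos (real p * t) = 2 * sin t)"
    (is "?L \<longleftrightarrow> ?R")
proof -
  define al where "al = pi / (2 * real p + 4)"
  have al: "0 < al" "al \<le> pi / 2" by (auto simp: al_def field_simps)
  have root: "poly (chebyshev_T p) (sqrt (1 - (sin t)\<^sup>2)) = cos (real p * t)"
    if "0 < t" "t < al" for t
  proof -
    have "0 \<le> cos t" using that al by (intro cos_ge_zero) auto
    then have "sqrt (1 - (sin t)\<^sup>2) = cos t" by (simp add: cos_squared_eq[symmetric])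
    then show ?thesis by (simp add: poly_chebyshev_T_cos)
  qed
  show ?thesis
  proof
    assume L: ?L
    then have x: "0 < x" "x < sin al" by (auto simp: lambda_solution_def al_def)
    let ?t = "arcsin x"
    have le: "x \<le> 1" using x sin_le_one[of al] by linarith
    then have s: "sin ?t = x" using x by simp
    have "0 < ?t" using x le arcsin_less_arcsin[of 0 x] by simp
    moreover have "?t < arcsin (sin al)" using x by (intro arcsin_less_arcsin) auto
    then have "?t < al" using al by (simp add: arcsin_sin)
    ultimately show ?R using root[of ?t] L s
      by (intro exI[of _ ?t]) (simp add: lambda_solution_def al_def)
  next
    assume ?R
    then obtain t where t: "0 < t" "t < al" "x = sin t" "cos (real p * t) = 2 * sin t"
      by (auto simp: al_def)
    moreover have "0 < sin t" using t al by (intro sin_gt_zero) auto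
    moreover have "sin t < sin al" using t al by (intro sin_monotone_2pi) auto
    ultimately show ?L using root by (simp add: lambda_solution_def al_def)
  qed
qed

lemma ex1_lambda_solution:
  assumes "1 \<le> p"
  shows "\<exists>!x. lambda_solution p x"
proof -
  define al where "al = pi / (2 * real p + 4)"
  let ?f = "\<lambda>t. 2 * sin t - cos (real p * t)"
  have al: "0 < al" "al < pi / 2"
    by (auto simp: al_def field_simps add_pos_nonneg)
  \<comment> \<open>at the right end, the left side of the equation is \<open>sin (2 al)\<close>, which is below \<open>2 sin al\<close>\<close>
  have pal: "real p * al = pi / 2 - 2 * al" by (simp add: al_def field_simps)
  then have "cos (real p * al) = sin (2 * al)"
    by (simp only: cos_diff) simp
  also have "\<dots> = 2 * sin al * cos al" by (rule sin_double)
  also have "\<dots> < 2 * sin al"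
  proof -
    have "0 < sin al" using al by (intro sin_gt_zero) auto
    moreover have "cos al < cos 0" using al by (intro cos_monotone_0_pi) auto
    ultimately show ?thesis by simp
  qed
  finally have end_pos: "0 < ?f al" by simp
  have "\<exists>t\<ge>0. t \<le> al \<and> ?f t = 0"
    using end_pos al by (intro IVT') (auto intro!: continuous_intros)
  then obtain t where t: "0 \<le> t" "t \<le> al" "?f t = 0" by blast
  have "t \<noteq> 0" using t(3) by auto
  moreover have "t \<noteq> al" using t(3) end_pos by auto
  ultimately have tt: "0 < t" "t < al" using t by auto
  then have sol: "lambda_solution p (sin t)"
    using t(3) by (auto simp: lambda_solution_iff al_def)
  have strict: "?f s < ?f u" if "0 < s" "s < u" "u < al" for s u
  proof -
    have "sin s < sin u" using that al by (intro sin_monotone_2pi) auto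
    moreover have "cos (real p * u) < cos (real p * s)"
    proof (rule cos_monotone_0_pi)
      have "real p * u \<le> real p * al" using that by (intro mult_left_mono) auto
      then show "real p * u \<le> pi" using al pal by linarith
    qed (use that assms in auto)
    ultimately show ?thesis by simp
  qed
  show ?thesis
  proof (rule ex1I, rule sol)
    fix y assume "lambda_solution p y"
    then obtain u where u: "0 < u" "u < al" "y = sin u" "?f u = 0"
      by (auto simp: lambda_solution_iff al_def)
    have "\<not> u < t" "\<not> t < u" using strict[of u t] strict[of t u] u t(3) tt by auto
    then show "y = sin t" using u by simp
  qed
qed

lemma lambda_eq_sin:
  assumes "4 \<le> n" and p: "p = cheb_index n"
  obtains t where "0 < t" "t < pi / (2 * real p + 4)" "lambda n = sin t"
    "cos (real p * t) = 2 * sin t"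
proof -
  have "1 \<le> p" using assms by (simp add: cheb_index_def)
  then have "lambda_solution p (lambda n)"
    unfolding lambda_def p by (rule theI'[OF ex1_lambda_solution])
  then show ?thesis using that unfolding lambda_solution_iff by blast
qed

text \<open>
  With \<open>lambda n = sin t\<close>, the equation reads \<open>sin (pi / 2 - p t) = 2 sin t\<close>. As \<open>t < pi / 6\<close>, this
  is less than \<open>sin (3 t)\<close>, so \<open>pi / 2 - p t < 3 t\<close>. The resulting lower bound has the same leading
  term \<open>pi / (2 p)\<close> as the upper bound, which is what the limit needs.
\<close>

lemma lambda_bounds:
  assumes "4 \<le> n" and p: "p = cheb_index n"
  shows "0 < lambda n" "lambda n < sin (pi / (2 * real p + 4))" "sin (pi / (2 * real p + 6)) < lambda n"
proof -
  define al be where "al = pi / (2 * real p + 4)" and "be = pi / (2 * real p + 6)"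
  obtain t where t: "0 < t" "t < al" "lambda n = sin t" "cos (real p * t) = 2 * sin t"
    using lambda_eq_sin[OF assms] unfolding al_def .
  have p1: "1 \<le> p" using assms by (simp add: cheb_index_def)
  have al: "al \<le> pi / 6" using p1 by (simp add: al_def field_simps)
  have pos: "0 < lambda n" unfolding t(3) using t al by (intro sin_gt_zero) auto
  have upper: "lambda n < sin al" unfolding t(3) using t al by (intro sin_monotone_2pi) auto
  have "sin t < sin (pi / 6)" using t al by (intro sin_monotone_2pi) auto
  then have s: "sin t < 1 / 2" by (simp add: sin_30)
  have "(sin t)\<^sup>2 < (1 / 2)\<^sup>2" using s pos t(3) by (intro power_strict_mono) auto
  then have "0 < sin t * (1 - 4 * (sin t)\<^sup>2)" using pos t(3) by (simp add: power2_eq_square)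
  \<comment> \<open>the triple-angle formula\<close>
  also have "sin t * (1 - 4 * (sin t)\<^sup>2) = sin (2 * t + t) - 2 * sin t"
    unfolding sin_add sin_double cos_double_sin
    using sin_cos_squared_add[of t] by algebra
  finally have three: "2 * sin t < sin (2 * t + t)" by simp
  have "pi / 2 - real p * t < 2 * t + t"
  proof (rule ccontr)
    assume "\<not> ?thesis"
    moreover have "0 \<le> real p * t" using t(1) by simp
    ultimately have "sin (2 * t + t) \<le> sin (pi / 2 - real p * t)"
      using t(1) by (intro sin_monotone_2pi_le) linarith+
    then show False using three t(4) by (simp add: sin_diff)
  qed
  then have "be < t" by (simp add: be_def field_simps)
  moreover have "0 < be" by (simp add: be_def add_nonneg_pos)
  ultimately have lower: "sin be < lambda n"
    unfolding t(3) using t al by (intro sin_monotone_2pi) linarith+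
  show "0 < lambda n" "lambda n < sin (pi / (2 * real p + 4))" "sin (pi / (2 * real p + 6)) < lambda n"
    using pos upper lower by (simp_all add: al_def be_def)
qed

text \<open>
  Since \<open>2 p + 2\<close> is \<open>n\<close> or \<open>n - 1\<close>, all terms are close to \<open>1 / pi\<close>; the fourth inequality is the
  upper estimate for the limit.
\<close>

lemma inverse_lambda_bounds:
  assumes n: "4 \<le> n" and p: "p = cheb_index n"
  shows "1 / (real n * sin (pi / (2 * real p + 4))) < 1 / (real n * lambda n)"
    and "(2 * real p + 4) / (real n * pi) < 1 / (real n * sin (pi / (2 * real p + 4)))"
    and "1 / pi < (2 * real p + 4) / (real n * pi)"
    and "1 / (real n * lambda n) < 1 / ((2 * real p + 2) * sin (pi / (2 * real p + 6)))"
proof -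
  define al be where "al = pi / (2 * real p + 4)" and "be = pi / (2 * real p + 6)"
  note lam = lambda_bounds[OF n p, folded al_def be_def]
  have "2 \<le> n div 2" using n by simp
  then have "2 * p + 2 = 2 * (n div 2)" by (simp add: p cheb_index_def)
  moreover have "2 * (n div 2) + n mod 2 = n" "n mod 2 < 2" by simp_all
  ultimately have "2 * p + 2 \<le> n" "n < 2 * p + 4" by linarith+
  then have np1: "2 * real p + 2 \<le> real n" and np2: "real n < 2 * real p + 4" by linarith+
  have al: "0 < al" "al \<le> pi / 2" by (auto simp: al_def field_simps)
  have sal: "sin al < al"
  proof -
    \<comment> \<open>strictness comes from the double-angle formula at \<open>al / 2\<close>\<close>
    have "cos (al / 2) < cos 0" using al by (intro cos_monotone_0_pi) auto
    moreover have "0 < sin (al / 2)" using al by (intro sin_gt_zero) auto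
    ultimately have "sin (2 * (al / 2)) < 2 * sin (al / 2)" unfolding sin_double by simp
    also have "\<dots> \<le> al" using sin_x_le_x[of "al / 2"] al by simp
    finally show ?thesis by simp
  qed
  show "1 / (real n * sin al) < 1 / (real n * lambda n)"
    using lam n by (intro divide_strict_left_mono mult_strict_left_mono mult_pos_pos) auto
  have "(2 * real p + 4) / (real n * pi) = 1 / (real n * al)"
    by (simp add: al_def)
  also have "\<dots> < 1 / (real n * sin al)"
    using sal lam n by (intro divide_strict_left_mono mult_strict_left_mono mult_pos_pos) auto
  finally show "(2 * real p + 4) / (real n * pi) < 1 / (real n * sin al)" .
  show "1 / pi < (2 * real p + 4) / (real n * pi)"
    using np2 n by (simp add: field_simps)
  have "0 < sin be"
    by (intro sin_gt_zero) (auto simp: be_def field_simps add_pos_nonneg)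
  then show "1 / (real n * lambda n) < 1 / ((2 * real p + 2) * sin be)"
    using lam n np1 by (intro divide_strict_left_mono mult_le_less_imp_less mult_pos_pos) auto
qed

lemma filterlim_cheb_index: "filterlim cheb_index at_top sequentially"
  unfolding filterlim_at_top
proof
  fix Z
  show "\<forall>\<^sub>F n in sequentially. Z \<le> cheb_index n"
  proof (rule eventually_sequentiallyI)
    fix n :: nat assume "2 * Z + 2 \<le> n"
    then have "(2 * Z + 2) div 2 \<le> n div 2" by (rule div_le_mono)
    then show "Z \<le> cheb_index n" by (simp add: cheb_index_def)
  qed
qed

lemma tendsto_inverse_lambda: "(\<lambda>n. 1 / (real n * lambda n)) \<longlonglongrightarrow> 1 / pi"
proof (rule tendsto_sandwich[of "\<lambda>_. 1 / pi"])
  let ?g = "\<lambda>p. 1 / ((2 * real p + 2) * sin (pi / (2 * real p + 6)))"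
  have "?g \<longlonglongrightarrow> inverse pi" by real_asymp
  then show "(\<lambda>n. ?g (cheb_index n)) \<longlonglongrightarrow> 1 / pi"
    unfolding inverse_eq_divide by (rule filterlim_compose[OF _ filterlim_cheb_index])
  show "\<forall>\<^sub>F n in sequentially. 1 / (real n * lambda n) \<le> ?g (cheb_index n)"
    by (rule eventually_sequentiallyI[of 4]) (rule less_imp_le[OF inverse_lambda_bounds(4)[OF _ refl]])
  show "\<forall>\<^sub>F n in sequentially. 1 / pi \<le> 1 / (real n * lambda n)"
  proof (rule eventually_sequentiallyI)
    fix n :: nat assume n: "4 \<le> n"
    show "1 / pi \<le> 1 / (real n * lambda n)"
      using inverse_lambda_bounds(1-3)[OF n refl] by linarith
  qed
qed (rule tendsto_const)

section \<open>The extremal configuration\<close>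

lemma in_set_append_update:
  "x \<in> set xs \<Longrightarrow> x \<in> set ys \<Longrightarrow> x \<in> set ((xs @ ys)[i := y])"
  by (simp add: list_update_append)

text \<open>
  On the unit circle of the plane spanned by \<open>u\<close> and \<open>v\<close>, start at \<open>c 0 = u\<close> and take \<open>p\<close> steps of
  length \<open>2 sin th\<close> towards the antipode \<open>- u\<close>, to \<open>c 1, \<dots>, c p\<close>. The equation for \<open>th\<close> says that
  the remaining chord from \<open>c p\<close> to \<open>- u\<close> has twice the length of a step, so that its midpoint
  completes a chain of equal steps from \<open>u\<close> to \<open>- u\<close>.

  The angle between \<open>u\<close> and \<open>- u\<close> at \<open>c p\<close> is right. So if \<open>z\<close> were exactly this midpoint, \<open>c p\<close>
  would lie on the boundary of the ball with diameter \<open>uz\<close>, which is longer than a step, and for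
  \<open>p = 1\<close> that ball would be an inner
  ball. Therefore \<open>z\<close> is moved by a small \<open>ep\<close> in the direction of \<open>- u\<close>, which makes the angle
  obtuse; the bound on \<open>ep\<close> keeps \<open>z\<close> strictly inside the balls with diameters \<open>c i, - u\<close>.
\<close>

locale doubled_arc =
  fixes u v :: "'a::euclidean_space" and p :: nat and th ep :: real
  assumes uu: "u \<bullet> u = 1" and vv: "v \<bullet> v = 1" and uv: "u \<bullet> v = 0"
    and p: "1 \<le> p" and th: "0 < th" "real p * th < pi / 2"
    and eq: "cos (real p * th) = 2 * sin th"
    and ep: "0 < ep" "ep \<le> (sin th)\<^sup>2"
begin

definition P :: "real \<Rightarrow> 'a" where "P s = cos s *\<^sub>R u + sin s *\<^sub>R v"

definition c :: "nat \<Rightarrow> 'a" where "c k = P (2 * real k * th)"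

definition z :: 'a where "z = midpoint (c p) (- u) - ep *\<^sub>R u"

lemma inner_P: "P s \<bullet> P t = cos (s - t)"
  using uu vv uv by (simp add: P_def inner_simps inner_commute cos_diff)

lemma P_0: "P 0 = u" and P_pi: "P pi = - u"
  by (simp_all add: P_def)

lemma c_0: "c 0 = u"
  by (simp add: c_def P_0)

text \<open>
  The inscribed angle theorem as a product formula: the sign of each factor can be read off from
  the order of the three points on the circle.
\<close>

lemma inner_diff_P:
  "(P s - P r) \<bullet> (P t - P r) = 4 * sin ((s - r) / 2) * sin ((t - r) / 2) * cos ((t - s) / 2)"
proof -
  define x y where "x = (s - r) / 2" and "y = (t - r) / 2"
  have arg: "s - t = 2 * x - 2 * y" "s - r = 2 * x" "r - t = - (2 * y)"
    by (simp_all add: x_def y_def field_simps)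
  have "(P s - P r) \<bullet> (P t - P r) = cos (s - t) - cos (s - r) - cos (r - t) + 1"
    by (simp add: inner_diff_left inner_diff_right inner_P)
  also have "\<dots> = cos (2 * x - 2 * y) - cos (2 * x) - cos (2 * y) + 1"
    unfolding arg cos_minus ..
  also have "\<dots> = 4 * sin x * sin y * (cos y * cos x + sin y * sin x)"
    unfolding cos_diff sin_double cos_double_sin by (simp add: algebra_simps power2_eq_square)
  also have "cos y * cos x + sin y * sin x = cos ((t - s) / 2)"
    unfolding cos_diff[symmetric] by (simp add: x_def y_def diff_divide_distrib)
  finally show ?thesis by (simp add: x_def y_def)
qed

lemma inner_diff_P_neg:
  assumes "s < r" "r < t" "t - s < pi"
  shows "(P s - P r) \<bullet> (P t - P r) < 0"
proof -
  have "0 < sin ((r - s) / 2)" "0 < sin ((t - r) / 2)" using assms by (auto intro!: sin_gt_zero)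
  moreover have "0 < cos ((t - s) / 2)" using assms by (intro cos_gt_zero) auto
  moreover have "sin ((s - r) / 2) = - sin ((r - s) / 2)"
    by (metis minus_diff_eq minus_divide_left sin_minus)
  ultimately show ?thesis unfolding inner_diff_P by simp
qed

lemma dist_P: "dist (P s) (P t) = 2 * \<bar>sin ((s - t) / 2)\<bar>"
proof -
  have "(dist (P s) (P t))\<^sup>2 = (P s - P t) \<bullet> (P s - P t)"
    by (simp add: dist_norm power2_norm_eq_inner)
  also have "\<dots> = (2 * \<bar>sin ((s - t) / 2)\<bar>)\<^sup>2"
    unfolding inner_diff_P by (simp add: power2_eq_square)
  finally show ?thesis by (rule power2_eq_imp_eq) auto
qed

lemma angle_le: "i \<le> j \<Longrightarrow> j \<le> p \<Longrightarrow> 2 * real i * th \<le> 2 * real j * th \<and> 2 * real j * th < pi"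
proof
  assume "i \<le> j" "j \<le> p"
  then show "2 * real i * th \<le> 2 * real j * th" using th by (intro mult_right_mono) auto
  have "real j * th \<le> real p * th" using \<open>j \<le> p\<close> th by (intro mult_right_mono) auto
  then show "2 * real j * th < pi" using th by linarith
qed

lemma angle_less: "i < j \<Longrightarrow> 2 * real i * th < 2 * real j * th"
  using th by simp

lemma sin_th: "0 < sin th" "(sin th)\<^sup>2 < 1" "ep < 1"
proof -
  have "1 * th \<le> real p * th" using p th by (intro mult_right_mono) auto
  then have t: "th < pi / 2" using th by linarith
  then show "0 < sin th" using th by (intro sin_gt_zero) auto
  have "0 < cos th" using t th by (intro cos_gt_zero) auto
  then have "0 < (cos th)\<^sup>2" by simp
  then show "(sin th)\<^sup>2 < 1" using sin_cos_squared_add[of th] by linarith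
  then show "ep < 1" using ep by linarith
qed

text \<open>
  The remaining arc has the half angle \<open>pi / 2 - p th\<close>, so the chord is \<open>2 cos (p th)\<close>, which the
  equation for \<open>th\<close> evaluates.
\<close>

lemma dist_last_antipode: "dist (- u) (c p) = 4 * sin th"
proof -
  have arg: "(pi - 2 * real p * th) / 2 = pi / 2 - real p * th" by (simp add: field_simps)
  have "sin ((pi - 2 * real p * th) / 2) = 2 * sin th"
    unfolding arg using eq by (simp add: sin_diff)
  then show ?thesis
    using sin_th unfolding P_pi[symmetric] c_def dist_P by simp
qed

lemma diff_z:
  "c p - z = ep *\<^sub>R u - (1/2) *\<^sub>R (- u - c p)"
  "- u - z = (1/2) *\<^sub>R (- u - c p) + ep *\<^sub>R u"
  by (rule euclidean_eqI,
      simp add: z_def midpoint_def inner_add_left inner_diff_left field_simps)+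

lemma norm_half_chord: "norm ((1/2) *\<^sub>R (- u - c p)) = 2 * sin th"
  using dist_last_antipode by (simp add: dist_norm)

lemma dist_z_le: "dist (c p) z \<le> 2 * sin th + ep" "dist z (- u) \<le> 2 * sin th + ep"
proof -
  have e: "norm (ep *\<^sub>R u) = ep" using uu ep by (simp add: norm_eq_sqrt_inner)
  show "dist (c p) z \<le> 2 * sin th + ep"
    unfolding dist_norm diff_z
    using norm_triangle_ineq4[of "ep *\<^sub>R u" "(1/2) *\<^sub>R (- u - c p)"] norm_half_chord e by linarith
  show "dist z (- u) \<le> 2 * sin th + ep"
    unfolding dist_commute[of z] unfolding dist_norm diff_z
    using norm_triangle_ineq[of "(1/2) *\<^sub>R (- u - c p)" "ep *\<^sub>R u"] norm_half_chord e by linarith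
qed

lemma inner_last_antipode_le:
  assumes "i \<le> p" shows "(c i - c p) \<bullet> (- u - c p) \<le> 0"
proof -
  define s r where "s = 2 * real i * th" and "r = 2 * real p * th"
  have a: "s \<le> r" "r < pi" "0 \<le> s" using angle_le[OF assms order_refl] th by (auto simp: s_def r_def)
  have "0 \<le> sin ((r - s) / 2)" using a pi_gt_zero by (auto intro!: sin_ge_zero)
  moreover have "sin ((s - r) / 2) = - sin ((r - s) / 2)"
    by (metis minus_diff_eq minus_divide_left sin_minus)
  moreover have "0 \<le> sin ((pi - r) / 2)" using a pi_gt_zero by (auto intro!: sin_ge_zero)
  moreover have "0 \<le> cos ((pi - s) / 2)" using a pi_gt_zero by (auto intro!: cos_ge_zero)
  ultimately show ?thesis
    unfolding P_pi[symmetric] c_def s_def[symmetric] r_def[symmetric] inner_diff_P by (simp add: mult_nonneg_nonneg)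
qed

lemma inner_c_u: "c i \<bullet> u = cos (2 * real i * th)"
  using inner_P[of _ 0] by (simp add: c_def P_0)

text \<open>
  The midpoint of the last chord contributes a nonpositive term, which vanishes for \<open>i = 0\<close>; the
  displacement by \<open>ep\<close> makes the sum negative.
\<close>

lemma last_blocks_z:
  assumes "i < p" shows "(c i - c p) \<bullet> (z - c p) < 0"
proof -
  have "z - c p = - (c p - z)" by simp
  also have "\<dots> = (1/2) *\<^sub>R (- u - c p) - ep *\<^sub>R u"
    unfolding diff_z by (rule minus_diff_eq)
  finally have zc: "z - c p = (1/2) *\<^sub>R (- u - c p) - ep *\<^sub>R u" .
  have "(c i - c p) \<bullet> (z - c p)
      = (1/2) * ((c i - c p) \<bullet> (- u - c p)) - ep * (c i \<bullet> u - c p \<bullet> u)"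
    unfolding zc inner_diff_right[of _ "_ *\<^sub>R _"] inner_scaleR_right
    by (simp add: inner_diff_left)
  moreover have "cos (2 * real p * th) < cos (2 * real i * th)"
    using angle_less[OF assms] angle_le[of i p] assms th by (intro cos_monotone_0_pi) auto
  then have "0 < ep * (c i \<bullet> u - c p \<bullet> u)" unfolding inner_c_u using ep by simp
  ultimately show ?thesis using inner_last_antipode_le[of i] assms by linarith
qed

text \<open>
  The ball with diameter \<open>c p, - u\<close> is nearly centred at \<open>z\<close>, and replacing \<open>c p\<close> by \<open>c i\<close>
  lowers the inner product up to an error of at most \<open>2 * ep\<close>. So the condition
  \<open>2 * ep + ep\<^sup>2 < 4 * (sin th)\<^sup>2\<close> suffices.
\<close>

lemma z_blocks_antipode:
  assumes "i \<le> p" shows "(c i - z) \<bullet> (- u - z) < 0"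
proof -
  let ?b = "- u" and ?w = "c p" and ?s = "(sin th)\<^sup>2"
  let ?h = "(1/2) *\<^sub>R (?b - ?w)"
  have "(c i - z) \<bullet> (?b - z) = (c i - ?w) \<bullet> (?b - z) + (?w - z) \<bullet> (?b - z)"
    by (simp flip: inner_add_left)
  also have "(c i - ?w) \<bullet> (?b - z) = (1/2) * ((c i - ?w) \<bullet> (?b - ?w)) + ep * (c i \<bullet> u - ?w \<bullet> u)"
    unfolding diff_z by (simp add: inner_add_right inner_diff_left)
  also have "(?w - z) \<bullet> (?b - z) = ep\<^sup>2 - ?h \<bullet> ?h"
    unfolding diff_z using uu
    by (simp add: inner_simps inner_commute power2_eq_square algebra_simps)
  also have "?h \<bullet> ?h = 4 * ?s"
    unfolding power2_norm_eq_inner[symmetric] norm_half_chord by (simp add: power_mult_distrib)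
  finally have e: "(c i - z) \<bullet> (?b - z) = (1/2) * ((c i - ?w) \<bullet> (?b - ?w))
      + ep * (c i \<bullet> u - ?w \<bullet> u) + (ep\<^sup>2 - 4 * ?s)" .
  have "c i \<bullet> u - ?w \<bullet> u \<le> 2"
    unfolding inner_c_u using cos_le_one[of "2 * real i * th"] cos_ge_minus_one[of "2 * real p * th"]
    by linarith
  then have "ep * (c i \<bullet> u - ?w \<bullet> u) \<le> ep * 2" using ep by (intro mult_left_mono) auto
  moreover have "ep\<^sup>2 \<le> ep * 1" unfolding power2_eq_square
    using ep sin_th by (intro mult_left_mono) auto
  ultimately show ?thesis
    using e inner_last_antipode_le[OF assms] ep sin_th by linarith
qed

lemma gabriel_pair_c_c:
  assumes S: "\<And>k. 1 \<le> k \<Longrightarrow> k \<le> p \<Longrightarrow> c k \<in> S"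
    and ij: "i < j" "j \<le> p" and g: "gabriel_pair S (c i) (c j)"
  shows "dist (c i) (c j) \<le> 2 * sin th"
proof (cases "j = Suc i")
  case True
  have "(2 * real i * th - 2 * real j * th) / 2 = - th" unfolding True by (simp add: algebra_simps)
  then show ?thesis using sin_th unfolding c_def dist_P by simp
next
  case False
  have "(c i - c (Suc i)) \<bullet> (c j - c (Suc i)) < 0"
    unfolding c_def
  proof (rule inner_diff_P_neg)
    have "0 \<le> 2 * real i * th" using th by simp
    then show "2 * real j * th - 2 * real i * th < pi" using angle_le[of j j] ij by linarith
    show "2 * real i * th < 2 * real (Suc i) * th" by (rule angle_less) simp
    show "2 * real (Suc i) * th < 2 * real j * th" using False ij by (intro angle_less) simp
  qed
  then show ?thesis using g S[of "Suc i"] ij unfolding gabriel_pair_def by force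
qed

text \<open>
  As soon as \<open>S\<close> contains \<open>c 1, \<dots>, c p\<close> and \<open>z\<close>, every pair that is not adjacent in the chain is
  blocked by a point of \<open>S\<close>, no matter whether the ends \<open>u\<close> and \<open>- u\<close> are in \<open>S\<close>. This is why the
  inner points of the chain have to be doubled, but not its ends.
\<close>

lemma gabriel_distance_le:
  assumes S: "\<And>k. 1 \<le> k \<Longrightarrow> k \<le> p \<Longrightarrow> c k \<in> S" "z \<in> S"
    and sub: "S \<subseteq> insert z (insert (- u) (c ` {..p}))"
    and g: "gabriel_pair S x y"
  shows "dist x y \<le> 2 * sin th + ep"
proof -
  have cc: "dist (c i) (c j) \<le> 2 * sin th + ep" if "gabriel_pair S (c i) (c j)" "i \<le> p" "j \<le> p" for i j
  proof -
    have "i \<noteq> j" using that by (auto simp: gabriel_pair_def)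
    then consider "i < j" | "j < i" by linarith
    then have "dist (c i) (c j) \<le> 2 * sin th"
      using gabriel_pair_c_c[OF S(1), of i j] gabriel_pair_c_c[OF S(1), of j i] that
        gabriel_pair_commute[of S "c i"] dist_commute[of "c i"] by cases auto
    then show ?thesis using ep by simp
  qed
  have cz: "dist (c i) z \<le> 2 * sin th + ep" if "gabriel_pair S (c i) z" "i \<le> p" for i
  proof (cases "i = p")
    case False
    then show ?thesis
      using last_blocks_z[of i] that S(1)[of p] p unfolding gabriel_pair_def by force
  qed (use dist_z_le in simp)
  have cb: "\<not> gabriel_pair S (c i) (- u)" if "i \<le> p" for i
    using z_blocks_antipode[OF that] S(2) unfolding gabriel_pair_def by force
  have x: "x = z \<or> x = - u \<or> (\<exists>i\<le>p. x = c i)" and y: "y = z \<or> y = - u \<or> (\<exists>i\<le>p. y = c i)"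
    and "x \<noteq> y"
    using g sub by (auto simp: gabriel_pair_def)
  have g': "gabriel_pair S y x" using g gabriel_pair_commute by blast
  from x y show ?thesis
  proof (elim disjE exE conjE)
    fix i j assume "i \<le> p" "j \<le> p" "x = c i" "y = c j"
    then show ?thesis using cc g by blast
  next
    fix i assume "i \<le> p" "x = c i" "y = z"
    then show ?thesis using cz g by blast
  next
    fix i assume "i \<le> p" "x = z" "y = c i"
    then show ?thesis using cz[of i] g' by (simp add: dist_commute)
  next
    fix i assume "i \<le> p" "x = c i" "y = - u"
    then show ?thesis using cb g by blast
  next
    fix i assume "i \<le> p" "x = - u" "y = c i"
    then show ?thesis using cb g' by blast
  qed (use dist_z_le(2) \<open>x \<noteq> y\<close> in \<open>auto simp: dist_commute\<close>)
qed

text \<open>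
  Every \<open>c k\<close> with \<open>1 \<le> k \<le> p\<close> occurs in both halves of the list and so survives the
  replacement of a single entry. This takes \<open>2 * p + 2\<close> entries; for odd \<open>n\<close>, a second copy of \<open>u\<close>
  fills the list.
\<close>

definition config :: "nat \<Rightarrow> 'a list" where
  "config n = ([u, - u] @ map c [1..<Suc p]) @ (map c [1..<Suc p] @ (if odd n then [u] else []))"

lemma antipode: "u \<noteq> - u" "dist u (- u) = 2"
proof -
  have "norm u = 1" using uu by (simp add: norm_eq_sqrt_inner)
  then have "norm (2 *\<^sub>R u) = 2" by simp
  then show "dist u (- u) = 2" by (simp add: dist_norm scaleR_2)
  then show "u \<noteq> - u" by force
qed

lemma length_config:
  assumes "p = cheb_index n" "4 \<le> n" shows "length (config n) = n"
proof -
  have "2 \<le> n div 2" using assms by simp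
  then have "2 * p + 2 = 2 * (n div 2)" by (simp add: assms cheb_index_def)
  moreover have "2 * (n div 2) + n mod 2 = n" by simp
  ultimately have "n = 2 * p + 2 + n mod 2" by linarith
  then show ?thesis by (cases "even n") (simp_all add: config_def odd_iff_mod_2_eq_one)
qed

lemma set_config: "set (config n) = insert (- u) (c ` {..p})"
proof -
  have "{..p} = insert 0 {1..<Suc p}" by auto
  then show ?thesis by (auto simp: config_def c_0)
qed

lemma largest_inner_diameter_config: "2 \<le> largest_inner_diameter (config n)"
proof -
  \<comment> \<open>all points lie on the unit circle, the boundary of the ball with diameter from \<open>u\<close> to \<open>- u\<close>\<close>
  have "(u - w) \<bullet> (- u - w) = w \<bullet> w - 1" for w
    using uu by (simp add: inner_simps inner_commute)
  moreover have "w \<bullet> w = 1" if "w \<in> set (config n)" for w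
    using that uu unfolding set_config by (auto simp: c_def inner_P)
  moreover have "u \<in> c ` {..p}" using c_0 by force
  ultimately have "gabriel_pair (set (config n)) u (- u)"
    using antipode(1) by (auto simp: gabriel_pair_def set_config)
  then have "dist u (- u) \<le> largest_inner_diameter (config n)"
    by (rule gabriel_pair_le_largest_inner_diameter)
  then show ?thesis unfolding antipode(2) .
qed

lemma largest_inner_diameter_config_update_le:
  assumes "i < length (config n)"
  shows "largest_inner_diameter ((config n)[i := z]) \<le> 2 * sin th + ep"
proof (rule largest_inner_diameter_le)
  fix x y assume "gabriel_pair (set ((config n)[i := z])) x y"
  then show "dist x y \<le> 2 * sin th + ep"
  proof (rule gabriel_distance_le[rotated 3])
    show "c k \<in> set ((config n)[i := z])" if "1 \<le> k" "k \<le> p" for k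
      using that unfolding config_def
      by (intro in_set_append_update) (auto simp del: upt_Suc)
    show "z \<in> set ((config n)[i := z])" using assms by (rule set_update_memI)
    show "set ((config n)[i := z]) \<subseteq> insert z (insert (- u) (c ` {..p}))"
      using set_update_subset_insert[of "config n" i z] by (simp add: set_config)
  qed
qed (use sin_th ep in auto)

lemma best_constant_ge:
  assumes n: "4 \<le> n" and pn: "p = cheb_index n"
  shows "2 / (real n * (2 * sin th + ep)) \<le> best_constant (UNIV :: 'a set) n largest_inner_diameter"
proof -
  let ?xs = "config n"
  let ?sum = "\<Sum>i<n. largest_inner_diameter (?xs[i := z])"
  have nd: "n_distance (UNIV :: 'a set) n largest_inner_diameter"
    using n by (intro n_distance_largest_inner_diameter) auto
  have len: "length ?xs = n" using length_config pn n by simp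
  have "{u, - u} \<subseteq> set ?xs" by (auto simp: config_def)
  moreover have "card {u, - u} = 2" using antipode(1) by simp
  ultimately have card: "2 \<le> card (set ?xs)" by (metis card_mono List.finite_set)
  have "largest_inner_diameter ?xs \<le> ?sum"
    using largest_inner_diameter_simplex_inequality[OF len] n by simp
  then have pos: "0 < ?sum" using largest_inner_diameter_config[of n] by linarith
  have "?sum \<le> (\<Sum>i<n. 2 * sin th + ep)"
    using largest_inner_diameter_config_update_le[of _ n] len by (intro sum_mono) auto
  then have "?sum \<le> real n * (2 * sin th + ep)" by simp
  then have "2 / (real n * (2 * sin th + ep)) \<le> largest_inner_diameter ?xs / ?sum"
    using largest_inner_diameter_config[of n] pos by (intro frac_le) auto
  also have "\<dots> \<le> best_constant (UNIV :: 'a set) n largest_inner_diameter"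
    by (rule quotient_le_best_constant[OF nd len _ _ card]) auto
  finally show ?thesis .
qed

end

section \<open>The lower bound for the best constant\<close>

text \<open>
  For each small displacement \<open>e\<close>, the configuration has value at least \<open>2\<close>, while each of its \<open>n\<close>
  modifications has value at most \<open>2 * lambda n + e\<close>. The claim is the limit \<open>e \<rightarrow> 0\<close>.
\<close>

lemma best_constant_largest_inner_diameter_ge:
  fixes u v :: "'a::euclidean_space"
  assumes uv: "u \<bullet> u = 1" "v \<bullet> v = 1" "u \<bullet> v = 0" and n: "4 \<le> n"
  shows "1 / (real n * lambda n) \<le> best_constant (UNIV :: 'a set) n largest_inner_diameter"
proof -
  define p where "p = cheb_index n"
  obtain t where t: "0 < t" "t < pi / (2 * real p + 4)" "lambda n = sin t" "cos (real p * t) = 2 * sin t"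
    using lambda_eq_sin[OF n p_def] .
  have pos: "0 < sin t" using lambda_bounds(1)[OF n p_def] t(3) by simp
  have "(2 * real p + 4) * t < pi" using t(2) by (simp add: field_simps)
  then have pt: "real p * t < pi / 2" using t(1) by (simp add: algebra_simps)
  have p1: "1 \<le> p" using n by (simp add: p_def cheb_index_def)
  have "2 / (real n * (2 * sin t + e)) \<le> best_constant (UNIV :: 'a set) n largest_inner_diameter"
    if "0 < e" "e \<le> (sin t)\<^sup>2" for e
  proof -
    interpret doubled_arc u v p t e
      by unfold_locales (use uv p1 t pt that in auto)
    show ?thesis by (rule best_constant_ge[OF n p_def])
  qed
  then have "\<forall>\<^sub>F e in at_right 0. 2 / (real n * (2 * sin t + e))
      \<le> best_constant (UNIV :: 'a set) n largest_inner_diameter"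
    using pos by (intro eventually_at_rightI[of 0 "(sin t)\<^sup>2"]) auto
  moreover have "((\<lambda>e. 2 / (real n * (2 * sin t + e))) \<longlongrightarrow> 2 / (real n * (2 * sin t + 0))) (at_right 0)"
    using pos n by (intro tendsto_intros) auto
  ultimately have "2 / (real n * (2 * sin t + 0)) \<le> best_constant (UNIV :: 'a set) n largest_inner_diameter"
    by (intro tendsto_upperbound[where F = "at_right (0::real)"]) auto
  then show ?thesis using t(3) by (simp add: field_simps)
qed

theorem proposition3p5:
  fixes d :: "(real ^ 'q) list \<Rightarrow> real"
  assumes q: "CARD('q) \<ge> 2"
    and d: "d = largest_inner_diameter"
  shows "(\<forall>n::nat. n \<ge> 4 \<longrightarrow>
            (let p = cheb_index n in
              n_distance UNIV n d \<and>
              (\<exists>!x. lambda_solution p x) \<and>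
              best_constant UNIV n d \<ge> 1 / (real n * lambda n) \<and>
              1 / (real n * lambda n) > 1 / (real n * sin (pi / (2 * real p + 4))) \<and>
              1 / (real n * sin (pi / (2 * real p + 4))) > (2 * real p + 4) / (real n * pi) \<and>
              (2 * real p + 4) / (real n * pi) > 1 / pi))
         \<and> (\<lambda>n. 1 / (real n * lambda n)) \<longlonglongrightarrow> 1 / pi"
proof (intro conjI allI impI)
  fix n :: nat assume n: "4 \<le> n"
  define p where "p = cheb_index n"
  have p1: "1 \<le> p" using n by (simp add: p_def cheb_index_def)
  \<comment> \<open>two coordinate directions span the plane of the configuration\<close>
  obtain i j :: 'q where ij: "i \<noteq> j"
    using q card_2_iff' by (metis One_nat_def Suc_1 UNIV_I card_le_Suc0_iff_eq finite not_less_eq_eq)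
  have "1 / (real n * lambda n) \<le> best_constant UNIV n d"
    unfolding d using ij n
    by (intro best_constant_largest_inner_diameter_ge[of "axis i 1" "axis j 1"]) (auto simp: inner_axis_axis)
  moreover have "n_distance UNIV n d"
    unfolding d using n by (intro n_distance_largest_inner_diameter) auto
  ultimately show "let p = cheb_index n in
      n_distance UNIV n d \<and>
      (\<exists>!x. lambda_solution p x) \<and>
      best_constant UNIV n d \<ge> 1 / (real n * lambda n) \<and>
      1 / (real n * lambda n) > 1 / (real n * sin (pi / (2 * real p + 4))) \<and>
      1 / (real n * sin (pi / (2 * real p + 4))) > (2 * real p + 4) / (real n * pi) \<and>
      (2 * real p + 4) / (real n * pi) > 1 / pi"
    using ex1_lambda_solution[OF p1] inverse_lambda_bounds(1-3)[OF n p_def]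
    unfolding Let_def p_def[symmetric] by blast
qed (rule tendsto_inverse_lambda)

end
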